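(* Let $A$ be a $J$-self-adjoint operator in the Krein space $(\mathfrak{H},[\cdot,\cdot])$, $[x,y]=(Jx,y)$. Then $A$ has the property of generalized $\mathcal{C}$-symmetry if and only if there exists a maximal positive subspace $\mathfrak{L}_+$ of $(\mathfrak{H},[\cdot,\cdot])$ such that, with $\mathfrak{L}_-=\mathfrak{L}_+^{[\bot]}$, $A$ admits the decomposition $$A=A_+[\dot{+}]A_-,\qquad A_+=A\upharpoonright\mathfrak{L}_+,\quad A_-=A\upharpoonright\mathfrak{L}_-$$ with respect to the $J$-orthogonal sum $\mathfrak{H}\supset\mathfrak{H}'=\mathfrak{L}_+[\dot{+}]\mathfrak{L}_-$.
   Context: Setting. $\mathfrak{H}$ is a complex Hilbert space with scalar product $(\cdot,\cdot)$, and $J$ is a fundamental symmetry: $J=J^*$, $J^2=I$. Put $P_\pm=\frac12(I\pm J)$, $\mathfrak{H}_\pm=P_\pm\mathfrak{H}$, and assume $\dim\mathfrak{H}_+=\dim\mathfrak{H}_-=\infty$. With the indefinite metric $[x,y]:=(Jx,y)$, $(\mathfrak{H},[\cdot,\cdot])$ is called a Krein space. Subspaces. "Subspace" means closed linear subspace. A subspace $\mathfrak{L}$ is positive if $[x,x]>0$ for all $x\in\mathfrak{L}\setminus\{0\}$; it is maximal positive if it is not properly contained in another (closed) positive subspace. $\mathfrak{L}^{[\bot]}=\{x\in\mathfrak{H}: [x,y]=0\ \forall y\in\mathfrak{L}\}$. The symbol $[\dot{+}]$ denotes a direct sum whose summands are orthogonal with respect to $[\cdot,\cdot]$. For a maximal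 positive $\mathfrak{L}_+$, it is known that $\mathfrak{L}_-=\mathfrak{L}_+^{[\bot]}$ is maximal negative and that $\mathfrak{H}'=\mathfrak{L}_+[\dot{+}]\mathfrak{L}_-$ is a dense linear set in $\mathfrak{H}$ (not necessarily equal to $\mathfrak{H}$). $J$-self-adjointness. A densely defined linear operator $A$ in $\mathfrak{H}$ is $J$-self-adjoint if $A^*J=JA$ (equality of operators, including domains). Generalized $\mathcal{C}$-symmetry. A $J$-self-adjoint operator $A$ has the property of generalized $\mathcal{C}$-symmetry if there exists a linear densely defined (not necessarily bounded) operator $\mathcal{C}$ in $\mathfrak{H}$ such that (i) $\mathcal{C}^2=I$ (i.e. $\mathcal{C}$ maps $\mathcal{D}(\mathcal{C})$ into itself and $\mathcal{C}^2f=f$ for $f\in\mathcal{D}(\mathcal{C})$); (ii) $J\mathcal{C}$ is a positive self-adjoint operator in $\mathfrak{H}$ (positive: $(J\mathcal{C}x,x)>0$ for all nonzero $x\in\mathcal{D}(\mathcal{C})$); (iii) $\mathcal{D}(A)\subset\mathcal{D}(\mathcal{C})$ and $A\mathcal{C}=\mathcal{C}A$ (equality of operators with their natural domains). Decomposition of $A$. "$A=A_+[\dot{+}]A_-$ with respect to $\mathfrak{L}_+[\dot{+}]\mathfrak{L}_-$" means: $\mathcal{D}(A)=(\mathcal{D}(A)\cap\mathfrak{L}_+)\dot{+}(\mathcal{D}(A)\cap\mathfrak{L}_-)$ and $A$ maps $\mathcal{D}(A)\cap\mathfrak{L}_\pm$ into $\mathfrak{L}_\pm$; $A_\pm$ is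 the restriction of $A$ to $\mathcal{D}(A)\cap\mathfrak{L}_\pm$, regarded as an operator in $\mathfrak{L}_\pm$. *)

theory Defs
  imports "HOL-Analysis.Analysis" "HOL-Library.Complex_Order"
begin

section \<open>Complex Hilbert spaces\<close>

text \<open>
  The scalar product is linear in its first argument. The topology, the norm and completeness are
  those of \<^class>\<open>banach\<close>; \<open>scaleR_scaleC\<close> and \<open>norm_eq_sqrt_cinner\<close> tie them to the
  complex structure.
\<close>

class complex_hilbert = banach +
  fixes scaleC :: "complex \<Rightarrow> 'a \<Rightarrow> 'a"  (infixr "*\<^sub>C" 75)
    and cinner :: "'a \<Rightarrow> 'a \<Rightarrow> complex"
  assumes scaleC_add_right: "c *\<^sub>C (x + y) = c *\<^sub>C x + c *\<^sub>C y"
    and scaleC_add_left: "(c + d) *\<^sub>C x = c *\<^sub>C x + d *\<^sub>C x"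
    and scaleC_scaleC: "c *\<^sub>C (d *\<^sub>C x) = (c * d) *\<^sub>C x"
    and scaleC_one: "1 *\<^sub>C x = x"
    and scaleR_scaleC: "r *\<^sub>R x = complex_of_real r *\<^sub>C x"
    and cinner_commute: "cinner x y = cnj (cinner y x)"
    and cinner_add_left: "cinner (x + y) z = cinner x z + cinner y z"
    and cinner_scaleC_left: "cinner (c *\<^sub>C x) y = c * cinner x y"
    and cinner_ge_zero: "0 \<le> cinner x x"
    and cinner_eq_zero_iff: "cinner x x = 0 \<longleftrightarrow> x = 0"
    and norm_eq_sqrt_cinner: "norm x = sqrt (Re (cinner x x))"

global_interpretation complex_vector: vector_space "scaleC :: complex \<Rightarrow> 'a \<Rightarrow> 'a::complex_hilbert"
  by unfold_locales (simp_all add: scaleC_add_right scaleC_add_left scaleC_scaleC scaleC_one)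

text \<open>The predicate \<open>closed_csubspace\<close> is what the literature on Krein spaces calls a subspace.\<close>

definition closed_csubspace :: "'a::complex_hilbert set \<Rightarrow> bool" where
  "closed_csubspace L \<longleftrightarrow> closed L \<and> complex_vector.subspace L"

definition infinite_dimensional :: "'a::complex_hilbert set \<Rightarrow> bool" where
  "infinite_dimensional L \<longleftrightarrow> \<not> (\<exists>B. finite B \<and> L \<subseteq> complex_vector.span B)"


section \<open>Unbounded operators\<close>

text \<open>
  An operator is identified with its graph, so that its domain of definition is \<^const>\<open>Domain\<close>
  of the graph, and equality of graphs is equality of operators including their domains.
\<close>

type_synonym 'a op = "('a \<times> 'a) set"

definition linear_op :: "'a::complex_hilbert op \<Rightarrow> bool" where
  "linear_op T \<longleftrightarrow> single_valued T \<and> (0, 0) \<in> T \<and>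
     (\<forall>x u y v. (x, u) \<in> T \<longrightarrow> (y, v) \<in> T \<longrightarrow> (x + y, u + v) \<in> T) \<and>
     (\<forall>c x u. (x, u) \<in> T \<longrightarrow> (c *\<^sub>C x, c *\<^sub>C u) \<in> T)"

definition densely_defined :: "'a::complex_hilbert op \<Rightarrow> bool" where
  "densely_defined T \<longleftrightarrow> closure (Domain T) = UNIV"

definition everywhere_op :: "('a \<Rightarrow> 'a) \<Rightarrow> 'a op" where
  "everywhere_op f = {(x, f x) | x. True}"

text \<open>
  The product \<open>S \<cdot> T\<close> applies \<open>T\<close> first (whereas \<open>(O)\<close> applies its left argument first), on
  its natural domain: all \<open>x\<close> in the domain of \<open>T\<close> whose image lies in the domain of \<open>S\<close>.
\<close>

abbreviation op_comp :: "'a op \<Rightarrow> 'a op \<Rightarrow> 'a op"  (infixr "\<cdot>" 75) where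
  "S \<cdot> T \<equiv> T O S"

text \<open>
  The pairs \<open>(y, z)\<close> with \<open>(Tx, y) = (x, z)\<close> for all \<open>x\<close> in the domain of \<open>T\<close>; for densely
  defined \<open>T\<close> this is the graph of the adjoint operator.
\<close>

definition adjoint_op :: "'a::complex_hilbert op \<Rightarrow> 'a op" where
  "adjoint_op T = {(y, z). \<forall>(x, w) \<in> T. cinner w y = cinner x z}"

definition selfadjoint_op :: "'a::complex_hilbert op \<Rightarrow> bool" where
  "selfadjoint_op T \<longleftrightarrow> linear_op T \<and> densely_defined T \<and> adjoint_op T = T"

text \<open>In the order on \<^typ>\<open>complex\<close>, \<open>0 < z\<close> means that \<open>z\<close> is real and positive.\<close>

definition positive_op :: "'a::complex_hilbert op \<Rightarrow> bool" where
  "positive_op T \<longleftrightarrow> (\<forall>(x, w) \<in> T. x \<noteq> 0 \<longrightarrow> 0 < cinner w x)"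


section \<open>Krein spaces\<close>

definition fundamental_symmetry :: "('a::complex_hilbert \<Rightarrow> 'a) \<Rightarrow> bool" where
  "fundamental_symmetry J \<longleftrightarrow> selfadjoint_op (everywhere_op J) \<and> (\<forall>x. J (J x) = x)"

definition P_plus :: "('a::complex_hilbert \<Rightarrow> 'a) \<Rightarrow> 'a \<Rightarrow> 'a" where
  "P_plus J x = (1/2) *\<^sub>C (x + J x)"

definition P_minus :: "('a::complex_hilbert \<Rightarrow> 'a) \<Rightarrow> 'a \<Rightarrow> 'a" where
  "P_minus J x = (1/2) *\<^sub>C (x - J x)"

definition indef :: "('a::complex_hilbert \<Rightarrow> 'a) \<Rightarrow> 'a \<Rightarrow> 'a \<Rightarrow> complex" where
  "indef J x y = cinner (J x) y"

definition positive_subspace :: "('a::complex_hilbert \<Rightarrow> 'a) \<Rightarrow> 'a set \<Rightarrow> bool" where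
  "positive_subspace J L \<longleftrightarrow> closed_csubspace L \<and> (\<forall>x \<in> L - {0}. 0 < indef J x x)"

definition maximal_positive :: "('a::complex_hilbert \<Rightarrow> 'a) \<Rightarrow> 'a set \<Rightarrow> bool" where
  "maximal_positive J L \<longleftrightarrow> positive_subspace J L \<and> \<not> (\<exists>M. positive_subspace J M \<and> L \<subset> M)"

definition J_orthocomplement :: "('a::complex_hilbert \<Rightarrow> 'a) \<Rightarrow> 'a set \<Rightarrow> 'a set" where
  "J_orthocomplement J L = {x. \<forall>y \<in> L. indef J x y = 0}"

definition J_selfadjoint :: "('a::complex_hilbert \<Rightarrow> 'a) \<Rightarrow> 'a op \<Rightarrow> bool" where
  "J_selfadjoint J A \<longleftrightarrow> linear_op A \<and> densely_defined A \<and>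
     adjoint_op A \<cdot> everywhere_op J = everywhere_op J \<cdot> A"

text \<open>The equation \<open>C \<cdot> C = Id_on (Domain C)\<close> includes that \<open>C\<close> maps its domain into itself.\<close>

definition generalized_C_symmetry :: "('a::complex_hilbert \<Rightarrow> 'a) \<Rightarrow> 'a op \<Rightarrow> bool" where
  "generalized_C_symmetry J A \<longleftrightarrow> (\<exists>C. linear_op C \<and> densely_defined C \<and>
     C \<cdot> C = Id_on (Domain C) \<and>
     selfadjoint_op (everywhere_op J \<cdot> C) \<and> positive_op (everywhere_op J \<cdot> C) \<and>
     Domain A \<subseteq> Domain C \<and> A \<cdot> C = C \<cdot> A)"

definition op_restrict :: "'a op \<Rightarrow> 'a set \<Rightarrow> 'a op" where
  "op_restrict A L = {(x, w) \<in> A. x \<in> L}"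

definition J_orthogonal_direct :: "('a::complex_hilbert \<Rightarrow> 'a) \<Rightarrow> 'a set \<Rightarrow> 'a set \<Rightarrow> bool" where
  "J_orthogonal_direct J L M \<longleftrightarrow> L \<inter> M = {0} \<and> (\<forall>x \<in> L. \<forall>y \<in> M. indef J x y = 0)"

text \<open>
  The operator \<open>A\<close> is the J-orthogonal sum of its restrictions to \<open>L\<close> and \<open>M\<close>, each of which
  is an operator in the respective subspace. The sum of \<open>L\<close> and \<open>M\<close> need not be the whole
  space.
\<close>

definition decomposes :: "('a::complex_hilbert \<Rightarrow> 'a) \<Rightarrow> 'a op \<Rightarrow> 'a set \<Rightarrow> 'a set \<Rightarrow> bool" where
  "decomposes J A L M \<longleftrightarrow> J_orthogonal_direct J L M \<and>
     Domain A = {x + y | x y. x \<in> Domain A \<inter> L \<and> y \<in> Domain A \<inter> M} \<and>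
     op_restrict A L \<subseteq> L \<times> L \<and> op_restrict A M \<subseteq> M \<times> M"

end

theory Submission
  imports Defs
begin

text \<open>
  If \<open>C\<close> is a generalized symmetry, take for \<open>L\<close> its eigenspace to the eigenvalue 1; by
  self-adjointness of \<open>JC\<close>, the J-orthogonal complement of \<open>L\<close> is the eigenspace to \<open>-1\<close>.
  Equality of the natural domains of \<open>AC\<close> and \<open>CA\<close> makes \<open>C\<close> map the domain of \<open>A\<close> into itself.
  Conversely, let \<open>C\<close> be the identity on \<open>L\<close> and minus the identity on the J-orthogonal complement.
  Both directions rest on the fact that a positive closed subspace \<open>L\<close> is maximal iff
  \<open>P\<^sub>+ L = \<HH>\<^sub>+\<close>.
\<close>

section \<open>Complex Hilbert spaces\<close>

lemma cinner_add_right: "cinner x (y + z) = cinner x y + cinner x z"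
  for x :: "'a::complex_hilbert"
  by (metis cinner_add_left cinner_commute complex_cnj_add)

lemma cinner_scaleC_right: "cinner x (c *\<^sub>C y) = cnj c * cinner x y"
  for x :: "'a::complex_hilbert"
  by (metis cinner_commute cinner_scaleC_left complex_cnj_mult)

lemma cinner_diff_left: "cinner (x - y) z = cinner x z - cinner y z"
  for x :: "'a::complex_hilbert"
  using cinner_add_left[of "x - y" y z] by simp

lemma cinner_diff_right: "cinner x (y - z) = cinner x y - cinner x z"
  for x :: "'a::complex_hilbert"
  using cinner_add_right[of x "y - z" z] by simp

lemma cinner_zero_left [simp]: "cinner 0 x = 0" for x :: "'a::complex_hilbert"
  using cinner_diff_left[of x x x] by simp

lemma cinner_zero_right [simp]: "cinner x 0 = 0" for x :: "'a::complex_hilbert"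
  using cinner_diff_right[of x x x] by simp

lemma cinner_minus_left: "cinner (- x) y = - cinner x y" for x :: "'a::complex_hilbert"
  using cinner_diff_left[of 0 x y] by simp

lemma cinner_minus_right: "cinner x (- y) = - cinner x y" for x :: "'a::complex_hilbert"
  using cinner_diff_right[of x 0 y] by simp

lemmas cinner_simps = cinner_add_left cinner_add_right cinner_diff_left cinner_diff_right
  cinner_minus_left cinner_minus_right cinner_scaleC_left cinner_scaleC_right

lemma cinner_self: "cinner x x = complex_of_real ((norm x)\<^sup>2)" for x :: "'a::complex_hilbert"
  using cinner_ge_zero[of x]
  by (simp add: norm_eq_sqrt_cinner less_eq_complex_def complex_eq_iff)

lemma Re_cinner_commute: "Re (cinner y x) = Re (cinner x y)" for x :: "'a::complex_hilbert"
  by (metis cinner_commute cnj.simps(1))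

lemma power2_norm_diff: "(norm (x - y))\<^sup>2 = (norm x)\<^sup>2 + (norm y)\<^sup>2 - 2 * Re (cinner x y)"
  for x :: "'a::complex_hilbert"
proof -
  have "(norm (x - y))\<^sup>2 = Re (cinner (x - y) (x - y))"
    by (simp add: cinner_self)
  also have "\<dots> = Re (cinner x x) + Re (cinner y y) - (Re (cinner x y) + Re (cinner y x))"
    by (simp add: cinner_simps)
  finally show ?thesis
    by (simp add: cinner_self Re_cinner_commute)
qed

lemma power2_norm_add: "(norm (x + y))\<^sup>2 = (norm x)\<^sup>2 + (norm y)\<^sup>2 + 2 * Re (cinner x y)"
  for x :: "'a::complex_hilbert"
  using power2_norm_diff[of x "- y"] by (simp add: cinner_minus_right)

lemma norm_scaleC: "norm (c *\<^sub>C x) = cmod c * norm x" for x :: "'a::complex_hilbert"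
proof -
  have "complex_of_real ((norm (c *\<^sub>C x))\<^sup>2) = c * (cnj c * cinner x x)"
    by (simp only: cinner_self[symmetric] cinner_simps mult.left_commute)
  also have "\<dots> = complex_of_real ((cmod c * norm x)\<^sup>2)"
    by (simp add: cinner_self power_mult_distrib mult.assoc[symmetric] complex_norm_square[symmetric]
        del: of_real_power flip: of_real_power of_real_mult)
  finally show ?thesis
    by (metis norm_ge_zero of_real_eq_iff power2_eq_imp_eq zero_le_mult_iff)
qed

text \<open>The coefficient is the one that makes the difference orthogonal to \<open>y\<close>, so
  this is Pythagoras for the distance from \<open>x\<close> to the line through \<open>y\<close>.
  Nonnegativity of the left side gives Cauchy-Schwarz, and minimality of a distance gives
  orthogonality of the projection.\<close>

lemma cinner_best_multiple:
  fixes x y :: "'a::complex_hilbert"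
  assumes "y \<noteq> 0"
  shows "(norm (x - (cinner x y / cinner y y) *\<^sub>C y))\<^sup>2
    = (norm x)\<^sup>2 - (cmod (cinner x y))\<^sup>2 / (norm y)\<^sup>2"
proof -
  define c where "c = cinner x y / complex_of_real ((norm y)\<^sup>2)"
  have ny: "(norm y)\<^sup>2 \<noteq> 0"
    using assms by simp
  have "cinner x (c *\<^sub>C y) = complex_of_real ((cmod (cinner x y))\<^sup>2 / (norm y)\<^sup>2)"
    using complex_norm_square[of "cinner x y"]
    by (simp add: cinner_simps c_def mult.commute)
  moreover have "(norm (c *\<^sub>C y))\<^sup>2 = (cmod (cinner x y))\<^sup>2 / (norm y)\<^sup>2"
    using ny by (simp add: norm_scaleC c_def norm_divide norm_power power_mult_distrib
        power_divide field_simps flip: power_mult power_add)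
  ultimately show ?thesis
    unfolding cinner_self c_def[symmetric] by (simp add: power2_norm_diff)
qed

lemma Cauchy_Schwarz_cinner: "cmod (cinner x y) \<le> norm x * norm y"
  for x y :: "'a::complex_hilbert"
proof (cases "y = 0")
  case False
  then have "(cmod (cinner x y))\<^sup>2 / (norm y)\<^sup>2 \<le> (norm x)\<^sup>2"
    using cinner_best_multiple[OF False, of x]
      zero_le_power2[of "norm (x - (cinner x y / cinner y y) *\<^sub>C y)"] by linarith
  then have "(cmod (cinner x y))\<^sup>2 \<le> (norm x * norm y)\<^sup>2"
    using False by (simp add: field_simps power_mult_distrib)
  then show ?thesis
    by (rule power2_le_imp_le) simp
qed simp

text \<open>Bilinearity is over the reals here, so conjugate linearity in the second argument does
  no harm. The purpose is continuity.\<close>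

lemma bounded_bilinear_cinner: "bounded_bilinear (cinner :: 'a::complex_hilbert \<Rightarrow> _)"
proof
  show "\<exists>K. \<forall>a b. norm (cinner a (b :: 'a)) \<le> norm a * norm b * K"
    by (intro exI[of _ 1]) (simp add: Cauchy_Schwarz_cinner)
qed (simp_all add: cinner_simps scaleR_scaleC scaleR_conv_of_real)

lemma bounded_bilinear_scaleC: "bounded_bilinear (scaleC :: _ \<Rightarrow> 'a::complex_hilbert \<Rightarrow> 'a)"
proof
  show "\<exists>K. \<forall>a b. norm (a *\<^sub>C (b :: 'a)) \<le> norm a * norm b * K"
    by (intro exI[of _ 1]) (simp add: norm_scaleC)
qed (simp_all add: scaleC_add_left scaleC_add_right scaleR_scaleC scaleC_scaleC
    scaleR_conv_of_real mult.commute)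

lemmas tendsto_scaleC = bounded_bilinear.tendsto[OF bounded_bilinear_scaleC]
  and continuous_on_cinner = bounded_bilinear.continuous_on[OF bounded_bilinear_cinner]
  and continuous_on_scaleC = bounded_bilinear.continuous_on[OF bounded_bilinear_scaleC]

lemma parallelogram:
  "(norm (x + y))\<^sup>2 + (norm (x - y))\<^sup>2 = 2 * (norm x)\<^sup>2 + 2 * (norm y)\<^sup>2"
  for x y :: "'a::complex_hilbert"
  by (simp add: power2_norm_add power2_norm_diff)

section \<open>The projection theorem\<close>

lemma csubspace_scaleR:
  assumes "complex_vector.subspace L" "x \<in> L"
  shows "r *\<^sub>R x \<in> L"
  using assms by (simp add: scaleR_scaleC complex_vector.subspace_scale)

text \<open>Midpoints of a minimising sequence stay in \<open>L\<close>, so the parallelogram law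
  makes the sequence Cauchy; completeness and closedness provide the limit.\<close>

lemma nearest_point_exists:
  fixes x :: "'a::complex_hilbert"
  assumes "closed_csubspace L"
  obtains u where "u \<in> L" "\<And>v. v \<in> L \<Longrightarrow> norm (x - u) \<le> norm (x - v)"
proof -
  have cl: "closed L" and sub: "complex_vector.subspace L"
    using assms by (auto simp: closed_csubspace_def)
  have ne: "L \<noteq> {}"
    using complex_vector.subspace_0[OF sub] by auto
  define d where "d = infdist x L"
  have d0: "0 \<le> d"
    by (simp add: d_def infdist_nonneg)
  have d_le: "d \<le> norm (x - v)" if "v \<in> L" for v
    using infdist_le[OF that, of x] by (simp add: d_def dist_norm)
  have "\<exists>u\<in>L. norm (x - u) < d + e" if "e > 0" for e
  proof -
    have "infdist x L < d + e"
      using that by (simp add: d_def)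
    then show ?thesis
      using ne cINF_less_iff[OF ne bdd_below_image_dist, of x "d + e"]
      by (simp add: infdist_def dist_norm)
  qed
  then have "\<forall>n. \<exists>u\<in>L. norm (x - u) < d + inverse (real (Suc n))"
    by simp
  then obtain u where uL: "\<And>n. u n \<in> L"
    and u_less: "\<And>n. norm (x - u n) < d + inverse (real (Suc n))"
    by metis
  have lim_inv: "(\<lambda>n. d + inverse (real (Suc n))) \<longlonglongrightarrow> d + 0"
    by (intro tendsto_intros LIMSEQ_inverse_real_of_nat)
  have lim_d: "(\<lambda>n. norm (x - u n)) \<longlonglongrightarrow> d"
    by (rule tendsto_sandwich[OF _ _ tendsto_const])
      (use d_le uL u_less lim_inv in \<open>auto intro!: always_eventually less_imp_le\<close>)
  \<comment> \<open>The vectors \<open>x - u m\<close> and \<open>x - u n\<close> add up to twice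
    the vector from the midpoint to \<open>x\<close>, whose norm is at least \<open>d\<close>; the
    parallelogram law then bounds their difference.\<close>
  have diff_le: "(norm (u m - u n))\<^sup>2 \<le> 2 * ((norm (x - u m))\<^sup>2 - d\<^sup>2) + 2 * ((norm (x - u n))\<^sup>2 - d\<^sup>2)"
    for m n
  proof -
    have "(1/2) *\<^sub>R (u m + u n) \<in> L"
      by (intro csubspace_scaleR complex_vector.subspace_add sub uL)
    then have "d \<le> norm (x - (1/2) *\<^sub>R (u m + u n))"
      by (rule d_le)
    also have "x - (1/2) *\<^sub>R (u m + u n) = (1/2) *\<^sub>R ((x - u m) + (x - u n))"
      by (simp add: algebra_simps flip: scaleR_add_left)
    finally have "2 * d \<le> norm ((x - u m) + (x - u n))"
      by simp
    then have "(2 * d)\<^sup>2 \<le> (norm ((x - u m) + (x - u n)))\<^sup>2"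
      using d0 by (intro power_mono) auto
    moreover have "norm ((x - u m) - (x - u n)) = norm (u m - u n)"
      by (simp add: norm_minus_commute)
    ultimately show ?thesis
      using parallelogram[of "x - u m" "x - u n"] by (simp add: power_mult_distrib)
  qed
  have "Cauchy u"
  proof (rule metric_CauchyI)
    fix e :: real
    assume "e > 0"
    have "(\<lambda>n. (norm (x - u n))\<^sup>2 - d\<^sup>2) \<longlonglongrightarrow> d\<^sup>2 - d\<^sup>2"
      by (intro tendsto_intros lim_d)
    \<comment> \<open>Each of the two excesses enters \<open>diff_le\<close> with factor 2, so a
      quarter of \<open>e\<close> squared for each suffices.\<close>
    then have "\<forall>\<^sub>F n in sequentially. (norm (x - u n))\<^sup>2 - d\<^sup>2 < e\<^sup>2 / 4"
      using \<open>e > 0\<close> by (intro order_tendstoD(2)) auto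
    then obtain N where N: "\<And>n. n \<ge> N \<Longrightarrow> (norm (x - u n))\<^sup>2 - d\<^sup>2 < e\<^sup>2 / 4"
      by (auto simp: eventually_sequentially)
    have "dist (u m) (u n) < e" if "m \<ge> N" "n \<ge> N" for m n
    proof -
      have "(norm (u m - u n))\<^sup>2 < e\<^sup>2"
        by (rule order.strict_trans1[OF diff_le]) (use N[OF that(1)] N[OF that(2)] in argo)
      then show ?thesis
        using \<open>e > 0\<close> by (simp add: dist_norm power_less_imp_less_base)
    qed
    then show "\<exists>M. \<forall>m\<ge>M. \<forall>n\<ge>M. dist (u m) (u n) < e"
      by blast
  qed
  then obtain w where w: "u \<longlonglongrightarrow> w"
    using Cauchy_convergent_iff convergent_def by blast
  have "w \<in> L"
    using closed_sequentially[OF cl _ w] uL by blast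
  moreover have "(\<lambda>n. norm (x - u n)) \<longlonglongrightarrow> norm (x - w)"
    by (intro tendsto_intros w)
  then have "norm (x - w) = d"
    using lim_d LIMSEQ_unique by blast
  ultimately show ?thesis
    using that d_le by auto
qed

text \<open>At a nearest point \<open>u\<close>, subtracting from \<open>x - u\<close> its best
  multiple of \<open>v\<close> cannot shorten it, so \<open>cinner_best_multiple\<close> forces the
  coefficient to vanish.\<close>

lemma orthogonal_projection_exists:
  fixes x :: "'a::complex_hilbert"
  assumes "closed_csubspace L"
  obtains u where "u \<in> L" "\<And>v. v \<in> L \<Longrightarrow> cinner (x - u) v = 0"
proof -
  have sub: "complex_vector.subspace L"
    using assms by (auto simp: closed_csubspace_def)
  obtain u where u: "u \<in> L" "\<And>v. v \<in> L \<Longrightarrow> norm (x - u) \<le> norm (x - v)"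
    using nearest_point_exists[OF assms, of x] by blast
  have "cinner (x - u) v = 0" if v: "v \<in> L" for v
  proof (cases "v = 0")
    case False
    define c where "c = cinner (x - u) v / cinner v v"
    have "u + c *\<^sub>C v \<in> L"
      by (intro complex_vector.subspace_add complex_vector.subspace_scale sub u(1) v)
    then have "norm (x - u) \<le> norm (x - u - c *\<^sub>C v)"
      using u(2) by (simp add: diff_diff_eq)
    then have "(norm (x - u))\<^sup>2 \<le> (norm (x - u - c *\<^sub>C v))\<^sup>2"
      by (intro power_mono) auto
    then have "(cmod (cinner (x - u) v))\<^sup>2 / (norm v)\<^sup>2 \<le> 0"
      using cinner_best_multiple[OF False, of "x - u"] by (simp add: c_def)
    then show ?thesis
      using False by (simp add: divide_le_0_iff)
  qed simp
  with u(1) show ?thesis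
    using that by blast
qed

section \<open>Closures, density and closed graphs\<close>

lemma csubspace_closure:
  fixes D :: "'a::complex_hilbert set"
  assumes "complex_vector.subspace D"
  shows "complex_vector.subspace (closure D)"
proof (rule complex_vector.subspaceI)
  show "0 \<in> closure D"
    using complex_vector.subspace_0[OF assms] closure_subset by blast
next
  fix x y
  assume "x \<in> closure D" "y \<in> closure D"
  then obtain f g where "\<forall>n. f n \<in> D" "f \<longlonglongrightarrow> x" "\<forall>n. g n \<in> D" "g \<longlonglongrightarrow> y"
    by (auto simp: closure_sequential)
  then show "x + y \<in> closure D"
    unfolding closure_sequential
    by (intro exI[of _ "\<lambda>n. f n + g n"])
      (auto intro: tendsto_add complex_vector.subspace_add[OF assms])
next
  fix c x
  assume "x \<in> closure D"
  then obtain f where "\<forall>n. f n \<in> D" "f \<longlonglongrightarrow> x"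
    by (auto simp: closure_sequential)
  then show "c *\<^sub>C x \<in> closure D"
    unfolding closure_sequential
    by (intro exI[of _ "\<lambda>n. c *\<^sub>C f n"])
      (auto intro: tendsto_scaleC complex_vector.subspace_scale[OF assms])
qed

text \<open>Projecting \<open>x\<close> onto the closure leaves a remainder orthogonal to
  \<open>D\<close>, which the second assumption annihilates.\<close>

lemma csubspace_denseI:
  fixes D :: "'a::complex_hilbert set"
  assumes "complex_vector.subspace D"
    and "\<And>y. (\<And>x. x \<in> D \<Longrightarrow> cinner y x = 0) \<Longrightarrow> y = 0"
  shows "closure D = UNIV"
proof -
  have "x \<in> closure D" for x
  proof -
    have "closed_csubspace (closure D)"
      by (simp add: closed_csubspace_def csubspace_closure assms(1))
    then obtain u where u: "u \<in> closure D" "\<And>v. v \<in> closure D \<Longrightarrow> cinner (x - u) v = 0"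
      using orthogonal_projection_exists[of "closure D" x] by blast
    have "x - u = 0"
      by (rule assms(2)) (use u(2) closure_subset in blast)
    then show ?thesis
      using u(1) by simp
  qed
  then show ?thesis
    by blast
qed

text \<open>Each pair of \<open>T\<close> imposes one closed condition. This later makes the
  eigenspace of \<open>C\<close> closed.\<close>

lemma closed_adjoint_op: "closed (adjoint_op T)" for T :: "'a::complex_hilbert op"
proof -
  have "adjoint_op T = (\<Inter>(x, w)\<in>T. {p. cinner w (fst p) = cinner x (snd p)})"
    by (auto simp: adjoint_op_def)
  moreover have "closed {p. cinner w (fst p) = cinner x (snd p)}" for x w :: 'a
    by (intro closed_Collect_eq continuous_on_cinner continuous_intros)
  ultimately show ?thesis
    by (auto intro!: closed_INT)
qed

section \<open>Krein spaces\<close>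

locale krein_space =
  fixes J :: "'a::complex_hilbert \<Rightarrow> 'a"
  assumes fundamental_symmetry: "fundamental_symmetry J"
begin

section \<open>Algebra of the symmetry, the indefinite metric and \<open>P_plus\<close>\<close>

lemma J_J [simp]: "J (J x) = x"
  using fundamental_symmetry by (simp add: fundamental_symmetry_def)

lemma J_add: "J (x + y) = J x + J y"
  and J_scaleC: "J (c *\<^sub>C x) = c *\<^sub>C J x"
  using fundamental_symmetry
  by (auto simp: fundamental_symmetry_def selfadjoint_op_def linear_op_def everywhere_op_def)

lemma cinner_J: "cinner (J x) y = cinner x (J y)"
proof -
  have "(y, J y) \<in> adjoint_op (everywhere_op J)"
    using fundamental_symmetry
    by (auto simp: fundamental_symmetry_def selfadjoint_op_def everywhere_op_def)
  then show ?thesis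
    by (auto simp: adjoint_op_def everywhere_op_def)
qed

lemma J_diff: "J (x - y) = J x - J y"
  using J_add[of "x - y" y] by simp

lemma J_zero [simp]: "J 0 = 0"
  using J_diff[of 0 0] by simp

lemma J_minus: "J (- x) = - J x"
  using J_diff[of 0 x] by simp

text \<open>As \<open>J\<close> is its own inverse, statements about the graph of \<open>JC\<close>
  become statements about the graph of \<open>C\<close>.\<close>

lemma J_comp_iff: "(x, w) \<in> everywhere_op J \<cdot> C \<longleftrightarrow> (x, J w) \<in> C"
proof
  assume "(x, w) \<in> everywhere_op J \<cdot> C"
  then show "(x, J w) \<in> C"
    by (auto simp: everywhere_op_def)
next
  assume "(x, J w) \<in> C"
  moreover have "(J w, w) \<in> everywhere_op J"
    by (simp add: everywhere_op_def)
  ultimately show "(x, w) \<in> everywhere_op J \<cdot> C"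
    by blast
qed

lemma norm_J: "norm (J x) = norm x"
  by (simp add: norm_eq_sqrt_cinner cinner_J)

lemma bounded_linear_J: "bounded_linear J"
  by (rule bounded_linear_intro[of _ 1]) (simp_all add: J_add scaleR_scaleC J_scaleC norm_J)

lemma indef_commute: "indef J x y = cnj (indef J y x)"
  unfolding indef_def by (metis cinner_J cinner_commute)

lemma indef_add_left: "indef J (x + y) z = indef J x z + indef J y z"
  and indef_add_right: "indef J z (x + y) = indef J z x + indef J z y"
  and indef_diff_left: "indef J (x - y) z = indef J x z - indef J y z"
  and indef_diff_right: "indef J z (x - y) = indef J z x - indef J z y"
  and indef_scaleC_left: "indef J (c *\<^sub>C x) y = c * indef J x y"
  and indef_scaleC_right: "indef J x (c *\<^sub>C y) = cnj c * indef J x y"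
  by (simp_all add: indef_def J_add J_diff J_scaleC cinner_simps)

lemmas indef_simps = indef_add_left indef_add_right indef_diff_left indef_diff_right
  indef_scaleC_left indef_scaleC_right

lemma Im_indef_self: "Im (indef J x x) = 0"
  using indef_commute[of x x] by (simp add: complex_eq_iff)

lemma indef_self_pos_iff: "0 < indef J x x \<longleftrightarrow> 0 < Re (indef J x x)"
  by (simp add: less_complex_def Im_indef_self)

lemma indef_zero [simp]: "indef J 0 x = 0" "indef J x 0 = 0"
  by (simp_all add: indef_def)

lemma P_plus_add: "P_plus J (x + y) = P_plus J x + P_plus J y"
  and P_plus_diff: "P_plus J (x - y) = P_plus J x - P_plus J y"
  and P_plus_scaleC: "P_plus J (c *\<^sub>C x) = c *\<^sub>C P_plus J x"
  by (simp_all add: P_plus_def J_add J_diff J_scaleC scaleC_add_right scaleC_scaleC mult.commute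
      complex_vector.scale_right_diff_distrib)

lemma bounded_linear_P_plus: "bounded_linear (P_plus J)"
proof -
  have "bounded_linear (\<lambda>x. (1/2) *\<^sub>R (x + J x))"
    by (intro bounded_linear_intros bounded_linear_const_scaleR bounded_linear_add
        bounded_linear_ident bounded_linear_J)
  then show ?thesis
    by (simp add: P_plus_def[abs_def] scaleR_scaleC)
qed

lemma J_P_plus: "J (P_plus J x) = P_plus J x"
  by (simp add: P_plus_def J_scaleC J_add add.commute)

lemma P_plus_eq_self: "J x = x \<Longrightarrow> P_plus J x = x"
  by (simp add: P_plus_def flip: scaleR_2) (simp add: scaleR_scaleC scaleC_scaleC scaleC_one)

lemma cinner_P_plus: "cinner (P_plus J x) y = cinner x (P_plus J y)"
  by (simp add: P_plus_def cinner_simps cinner_J)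

text \<open>This translates the sign of \<open>[x, x]\<close> into a comparison between the norms of
  \<open>x\<close> and \<open>P_plus J x\<close>.\<close>

lemma power2_norm_P_plus: "(norm (P_plus J x))\<^sup>2 = ((norm x)\<^sup>2 + Re (indef J x x)) / 2"
  by (simp add: P_plus_def norm_scaleC power_mult_distrib power2_norm_add norm_J indef_def cinner_J
      norm_divide power_divide)

lemma indef_self_P_plus_zero:
  assumes "P_plus J x = 0"
  shows "Re (indef J x x) = - (norm x)\<^sup>2"
  using power2_norm_P_plus[of x] assms by simp

section \<open>J-orthogonal complements and maximal positive subspaces\<close>

lemma csubspace_J_orthocomplement: "complex_vector.subspace (J_orthocomplement J L)"
  by (rule complex_vector.subspaceI) (auto simp: J_orthocomplement_def indef_simps)

text \<open>If \<open>u\<close> is the projection of \<open>x\<close> onto \<open>L\<close>, then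
  \<open>J (x - u)\<close> is J-orthogonal to \<open>L\<close>. Testing \<open>x\<close> against it
  shows that \<open>x - u\<close> is orthogonal to \<open>x\<close>, hence to itself.\<close>

lemma J_orthocomplement_twice:
  assumes "closed_csubspace L"
  shows "J_orthocomplement J (J_orthocomplement J L) = L"
proof (intro equalityI subsetI)
  fix x
  assume x: "x \<in> J_orthocomplement J (J_orthocomplement J L)"
  obtain u where u: "u \<in> L" "\<And>v. v \<in> L \<Longrightarrow> cinner (x - u) v = 0"
    using orthogonal_projection_exists[OF assms, of x] by blast
  have "J (x - u) \<in> J_orthocomplement J L"
    using u(2) by (simp add: J_orthocomplement_def indef_def)
  then have "indef J x (J (x - u)) = 0"
    using x by (simp add: J_orthocomplement_def)
  then have "cinner x (x - u) = 0"
    by (simp add: indef_def cinner_J)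
  moreover have "cinner u (x - u) = 0"
    by (metis cinner_commute complex_cnj_zero u)
  ultimately have "cinner (x - u) (x - u) = 0"
    by (simp add: cinner_diff_left)
  then show "x \<in> L"
    using u(1) by (simp add: cinner_eq_zero_iff)
next
  fix x
  assume "x \<in> L"
  then show "x \<in> J_orthocomplement J (J_orthocomplement J L)"
    using indef_commute[of x] by (auto simp: J_orthocomplement_def)
qed

text \<open>On a positive subspace \<open>P_plus J\<close> is bounded below, so the image of
  \<open>L\<close> is closed and can be projected onto. The remainder of \<open>P_plus J y\<close>
  is a vector of \<open>\<HH>\<^sub>+\<close> that is J-orthogonal to \<open>L\<close>, which
  \<open>triv\<close> excludes unless it is zero.\<close>

lemma positive_subspace_P_plus_image:
  assumes L: "positive_subspace J L"
    and triv: "\<And>z. z \<in> J_orthocomplement J L \<Longrightarrow> J z = z \<Longrightarrow> z = 0"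
  shows "\<exists>x\<in>L. P_plus J x = P_plus J y"
proof -
  have cl: "closed L" and sub: "complex_vector.subspace L"
    using L by (auto simp: positive_subspace_def closed_csubspace_def)
  \<comment> \<open>Nonnegativity of \<open>[x, x]\<close> would even give the square root of 2; the
    constant 2 avoids the root.\<close>
  have bound: "norm x \<le> 2 * norm (P_plus J x)" if "x \<in> L" for x
  proof -
    have "0 \<le> Re (indef J x x)"
      using L that by (cases "x = 0") (auto simp: positive_subspace_def indef_self_pos_iff less_imp_le)
    then have "(norm x)\<^sup>2 \<le> (2 * norm (P_plus J x))\<^sup>2"
      using zero_le_power2[of "norm x"] by (simp add: power_mult_distrib power2_norm_P_plus)
    then show ?thesis
      by (rule power2_le_imp_le) simp
  qed
  have "closed_csubspace (P_plus J ` L)"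
    unfolding closed_csubspace_def
  proof
    have "complete (P_plus J ` L)"
    proof (rule complete_isometric_image[of "1/2"])
      show "subspace L"
        using sub csubspace_scaleR[OF sub]
        by (simp add: subspace_def complex_vector.subspace_0 complex_vector.subspace_add)
      show "\<forall>x\<in>L. 1/2 * norm x \<le> norm (P_plus J x)"
        using bound by (simp add: mult.commute)
      show "complete L"
        using cl by (simp add: complete_eq_closed)
    qed (simp_all add: bounded_linear_P_plus)
    then show "closed (P_plus J ` L)"
      by (simp add: complete_eq_closed)
    show "complex_vector.subspace (P_plus J ` L)"
    proof (rule complex_vector.subspaceI)
      show "0 \<in> P_plus J ` L"
        using complex_vector.subspace_0[OF sub] P_plus_diff[of 0 0] by force
      show "x + y \<in> P_plus J ` L" if "x \<in> P_plus J ` L" "y \<in> P_plus J ` L" for x y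
        using that complex_vector.subspace_add[OF sub] by (auto simp flip: P_plus_add)
      show "c *\<^sub>C x \<in> P_plus J ` L" if "x \<in> P_plus J ` L" for x c
        using that complex_vector.subspace_scale[OF sub] by (auto simp flip: P_plus_scaleC)
    qed
  qed
  then obtain u where u: "u \<in> P_plus J ` L"
    "\<And>v. v \<in> P_plus J ` L \<Longrightarrow> cinner (P_plus J y - u) v = 0"
    using orthogonal_projection_exists[of "P_plus J ` L" "P_plus J y"] by blast
  obtain x where x: "x \<in> L" "u = P_plus J x"
    using u(1) by blast
  define z where "z = P_plus J y - u"
  have Jz: "J z = z"
    by (simp add: z_def x(2) J_diff J_P_plus)
  \<comment> \<open>\<open>P_plus J\<close> is symmetric and fixes \<open>z\<close>, so
    orthogonality to \<open>P_plus J v\<close> passes to \<open>v\<close>; since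
    \<open>J z = z\<close>, it is J-orthogonality as well.\<close>
  have "indef J z v = 0" if "v \<in> L" for v
    using u(2)[of "P_plus J v"] that cinner_P_plus[of z v] P_plus_eq_self[OF Jz] Jz
    by (simp add: indef_def z_def[symmetric])
  then have "z = 0"
    using triv Jz by (simp add: J_orthocomplement_def)
  then show ?thesis
    using x z_def by auto
qed

text \<open>If \<open>M\<close> is larger, some \<open>m\<close> outside \<open>L\<close> has the
  same \<open>P_plus\<close> part as an \<open>x\<close> in \<open>L\<close>. Then
  \<open>m - x\<close> is a nonzero vector of \<open>M\<close> on which the metric is
  negative.\<close>

lemma maximal_positiveI:
  assumes L: "positive_subspace J L"
    and surj: "\<And>y. \<exists>x\<in>L. P_plus J x = P_plus J y"
  shows "maximal_positive J L"
  unfolding maximal_positive_def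
proof (intro conjI notI, fact L, elim exE conjE)
  fix M
  assume M: "positive_subspace J M" "L \<subset> M"
  then obtain m where m: "m \<in> M" "m \<notin> L"
    by blast
  obtain x where x: "x \<in> L" "P_plus J x = P_plus J m"
    using surj by blast
  have "m - x \<in> M"
    using M m x by (auto simp: positive_subspace_def closed_csubspace_def
        intro!: complex_vector.subspace_diff)
  moreover have "m - x \<noteq> 0"
    using m x by auto
  ultimately have "0 < Re (indef J (m - x) (m - x))"
    using M(1) by (auto simp: positive_subspace_def indef_self_pos_iff)
  then show False
    using indef_self_P_plus_zero[of "m - x"] x(2) by (simp add: P_plus_diff)
qed

text \<open>A vector \<open>z\<close> of \<open>\<HH>\<^sub>+\<close> that is J-orthogonal to \<open>L\<close> could be adjoined to \<open>L\<close>.\<close>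

lemma maximal_positive_orthocomplement_trivial:
  assumes L: "maximal_positive J L"
    and z: "z \<in> J_orthocomplement J L" "J z = z"
  shows "z = 0"
proof (rule ccontr)
  assume nz: "z \<noteq> 0"
  have pos: "positive_subspace J L"
    using L by (simp add: maximal_positive_def)
  then have cl: "closed L" and sub: "complex_vector.subspace L"
    by (auto simp: positive_subspace_def closed_csubspace_def)
  \<comment> \<open>The map \<open>q\<close> removes the component along \<open>z\<close>. Hence
    \<open>M\<close> is the sum of \<open>L\<close> and the line through \<open>z\<close>, and
    writing it as a preimage of \<open>L\<close> makes its closedness immediate.\<close>
  define q where "q y = y - (cinner y z / cinner z z) *\<^sub>C z" for y
  define M where "M = {y. q y \<in> L}"
  have orth: "cinner y z = 0" "indef J z y = 0" "indef J y z = 0" if "y \<in> L" for y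
  proof -
    show *: "indef J z y = 0"
      using z(1) that by (simp add: J_orthocomplement_def)
    show "indef J y z = 0"
      using * indef_commute[of y z] by simp
    then show "cinner y z = 0"
      by (simp add: indef_def cinner_J z(2))
  qed
  have q_add: "q (x + y) = q x + q y" for x y
    by (simp add: q_def cinner_add_left add_divide_distrib scaleC_add_left)
  have q_scale: "q (c *\<^sub>C x) = c *\<^sub>C q x" for c x
    by (simp add: q_def cinner_scaleC_left scaleC_scaleC complex_vector.scale_right_diff_distrib)
  have q_z: "q z = 0"
    using nz by (simp add: q_def cinner_eq_zero_iff scaleC_one)
  have "closed M"
  proof -
    have "continuous_on UNIV q"
      unfolding q_def
      using nz by (auto simp: cinner_eq_zero_iff
          intro!: continuous_intros continuous_on_scaleC continuous_on_cinner)
    then show ?thesis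
      using closed_vimage[OF cl] by (simp add: M_def vimage_def)
  qed
  moreover have "complex_vector.subspace M"
    by (rule complex_vector.subspaceI)
      (auto simp: M_def q_add q_scale sub complex_vector.subspace_add complex_vector.subspace_scale
        complex_vector.subspace_0 q_def[of 0])
  moreover have "0 < indef J y y" if "y \<in> M - {0}" for y
  proof -
    define c where "c = cinner y z / cinner z z"
    have l: "q y \<in> L"
      using that by (simp add: M_def)
    have y: "y = q y + c *\<^sub>C z"
      by (simp add: q_def c_def)
    \<comment> \<open>The mixed terms vanish because \<open>z\<close> is J-orthogonal to
      \<open>L\<close>. Both remaining terms are nonnegative, and they cannot both vanish for
      nonzero \<open>y\<close>.\<close>
    have "indef J y y = indef J (q y) (q y) + c * cnj c * indef J z z"
      by (subst (1 2) y) (simp add: indef_simps orth[OF l])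
    also have "indef J z z = complex_of_real ((norm z)\<^sup>2)"
      by (simp add: indef_def z(2) cinner_self)
    also have "c * cnj c = complex_of_real ((cmod c)\<^sup>2)"
      by (rule complex_norm_square[symmetric])
    finally have eq: "Re (indef J y y) = Re (indef J (q y) (q y)) + (cmod c)\<^sup>2 * (norm z)\<^sup>2"
      by (simp flip: of_real_mult of_real_power)
    show ?thesis
    proof (cases "q y = 0")
      case True
      then have "c \<noteq> 0"
        using y that by auto
      then show ?thesis
        using eq True nz by (simp add: indef_self_pos_iff)
    next
      case False
      then have "0 < Re (indef J (q y) (q y))"
        using pos l by (auto simp: positive_subspace_def indef_self_pos_iff)
      then show ?thesis
        using eq by (simp add: indef_self_pos_iff add_pos_nonneg)
    qed
  qed
  ultimately have "positive_subspace J M"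
    by (simp add: positive_subspace_def closed_csubspace_def)
  moreover have "L \<subseteq> M"
    by (auto simp: M_def q_def orth)
  moreover have "z \<in> M"
    by (simp add: M_def q_z complex_vector.subspace_0[OF sub])
  moreover have "z \<notin> L"
    using orth(1)[of z] nz by (auto simp: cinner_eq_zero_iff)
  ultimately show False
    using L by (auto simp: maximal_positive_def)
qed

text \<open>
  The idea: choose \<open>x\<close> in \<open>L\<close> with \<open>P\<^sub>+ x = P\<^sub>+ y\<close>, so that \<open>[y, y] + [x, x] = [y - x, y - x]\<close>
  equals \<open>- \<parallel>y - x\<parallel>\<^sup>2\<close>.
\<close>

lemma maximal_positive_orthocomplement_negative:
  assumes L: "maximal_positive J L"
    and y: "y \<in> J_orthocomplement J L" "y \<noteq> 0"
  shows "Re (indef J y y) < 0"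
proof -
  have pos: "positive_subspace J L"
    using L by (simp add: maximal_positive_def)
  obtain x where x: "x \<in> L" "P_plus J x = P_plus J y"
    using positive_subspace_P_plus_image[OF pos maximal_positive_orthocomplement_trivial[OF L]]
    by blast
  have yx: "indef J y x = 0"
    using x y by (simp add: J_orthocomplement_def)
  then have xy: "indef J x y = 0"
    using indef_commute[of x y] by simp
  have eq: "Re (indef J y y) + Re (indef J x x) = - (norm (y - x))\<^sup>2"
    using indef_self_P_plus_zero[of "y - x"] x(2) by (simp add: P_plus_diff indef_simps xy yx)
  show ?thesis
  \<comment> \<open>Strictness comes from \<open>y \<noteq> 0\<close> in the first case and from
    positivity of \<open>[x, x]\<close> in the second.\<close>
  proof (cases "x = 0")
    case True
    then show ?thesis
      using eq y(2) by simp
  next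
    case False
    then have "0 < Re (indef J x x)"
      using pos x(1) by (auto simp: positive_subspace_def indef_self_pos_iff)
    then show ?thesis
      using eq zero_le_power2[of "norm (y - x)"] by linarith
  qed
qed

section \<open>From a generalized symmetry to a decomposition\<close>

lemma decomposes_if_generalized_C_symmetry:
  assumes A: "linear_op A" and "generalized_C_symmetry J A"
  shows "\<exists>L. maximal_positive J L \<and> decomposes J A L (J_orthocomplement J L)"
proof -
  obtain C where C: "linear_op C" "C \<cdot> C = Id_on (Domain C)"
    and sa: "selfadjoint_op (everywhere_op J \<cdot> C)" and pos: "positive_op (everywhere_op J \<cdot> C)"
    and dom: "Domain A \<subseteq> Domain C" and comm: "A \<cdot> C = C \<cdot> A"
    using assms(2) by (auto simp: generalized_C_symmetry_def)
  have C_add: "(x + y, u + v) \<in> C" if "(x, u) \<in> C" "(y, v) \<in> C" for x y u v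
    using C(1) that by (auto simp: linear_op_def)
  have C_scale: "(c *\<^sub>C x, c *\<^sub>C u) \<in> C" if "(x, u) \<in> C" for c x u
    using C(1) that by (auto simp: linear_op_def)
  have C_zero: "(0, 0) \<in> C"
    using C(1) by (auto simp: linear_op_def)
  have C_fun: "u = v" if "(x, u) \<in> C" "(x, v) \<in> C" for x u v
    using C(1) that by (auto simp: linear_op_def single_valued_def)
  have C_swap: "(u, x) \<in> C" if xu: "(x, u) \<in> C" for x u
  proof -
    have "(x, x) \<in> C \<cdot> C"
      unfolding C(2) using xu by auto
    then show ?thesis
      using C_fun[OF xu] by blast
  qed
  have JC_I: "(x, J u) \<in> everywhere_op J \<cdot> C" if "(x, u) \<in> C" for x u
    using that by (simp add: J_comp_iff)
  have sym: "indef J u y = indef J x v" if "(x, u) \<in> C" "(y, v) \<in> C" for x y u v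
  proof -
    have "(y, J v) \<in> adjoint_op (everywhere_op J \<cdot> C)"
      using sa JC_I[OF that(2)] by (simp add: selfadjoint_op_def)
    then have "cinner (J u) y = cinner x (J v)"
      using JC_I[OF that(1)] by (auto simp: adjoint_op_def)
    then show ?thesis
      by (simp add: indef_def cinner_J)
  qed
  define L where "L = {x. (x, x) \<in> C}"
  define M where "M = {x. (x, - x) \<in> C}"
  \<comment> \<open>The usual splitting for an involution. The explicit formulas for
    \<open>a\<close> and \<open>b\<close> are kept because they later show that both lie in the
    domain of \<open>A\<close>.\<close>
  have split: "\<exists>a\<in>L. \<exists>b\<in>M. x = a + b \<and> u = a - b \<and> a = (1/2) *\<^sub>C (x + u) \<and> b = (1/2) *\<^sub>C (x - u)"
    if "(x, u) \<in> C" for x u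
  proof -
    have "(x - u, u - x) \<in> C"
      using C_add[OF that C_scale[OF C_swap[OF that], of "-1"]] by (simp add: scaleC_one)
    then have "(1/2) *\<^sub>C (x - u) \<in> M"
      using C_scale[of "x - u" "u - x" "1/2"]
      by (simp add: M_def complex_vector.scale_right_diff_distrib)
    moreover have "(1/2) *\<^sub>C (x + u) \<in> L"
      using C_scale[OF C_add[OF that C_swap[OF that]], of "1/2"] by (simp add: L_def add.commute)
    moreover have "x = (1/2) *\<^sub>C (x + u) + (1/2) *\<^sub>C (x - u)"
      "u = (1/2) *\<^sub>C (x + u) - (1/2) *\<^sub>C (x - u)"
      by (simp_all add: scaleC_add_right complex_vector.scale_right_diff_distrib scaleC_one
          flip: scaleC_add_left)
    ultimately show ?thesis
      by blast
  qed
  \<comment> \<open>A self-adjoint operator is its own adjoint, so \<open>JC\<close> has a closed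
    graph, and the graph of \<open>C\<close> is its preimage under a continuous map.\<close>
  have C_closed: "closed C"
  proof -
    have "C = (\<lambda>p. (fst p, J (snd p))) -` adjoint_op (everywhere_op J \<cdot> C)"
      using sa by (intro set_eqI) (simp add: selfadjoint_op_def J_comp_iff)
    moreover have "closed ((\<lambda>p. (fst p, J (snd p))) -` adjoint_op (everywhere_op J \<cdot> C))"
      by (intro closed_vimage closed_adjoint_op continuous_intros
          bounded_linear.continuous_on[OF bounded_linear_J])
    ultimately show ?thesis
      by simp
  qed
  have "closed L"
    using closed_vimage[OF C_closed, of "\<lambda>x. (x, x)"]
    by (simp add: L_def vimage_def continuous_on_Pair continuous_on_id)
  then have "closed_csubspace L"
    by (auto simp: closed_csubspace_def L_def C_zero C_add C_scale
        intro!: complex_vector.subspaceI)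
  moreover have "0 < indef J x x" if "x \<in> L - {0}" for x
    using pos JC_I[of x x] that by (auto simp: L_def positive_op_def indef_def)
  ultimately have L_pos: "positive_subspace J L"
    by (simp add: positive_subspace_def)
  have M_neg: "Re (indef J x x) < 0" if "x \<in> M" "x \<noteq> 0" for x
  proof -
    have "0 < cinner (J (- x)) x"
      using pos JC_I[of x "- x"] that by (auto simp: M_def positive_op_def)
    then show ?thesis
      by (simp add: indef_def J_minus cinner_minus_left less_complex_def)
  qed
  have orth: "indef J x y = 0" "indef J y x = 0" if "x \<in> L" "y \<in> M" for x y
  proof -
    have "indef J x y = indef J x (- y)"
      using that by (intro sym) (auto simp: L_def M_def)
    then show "indef J x y = 0"
      by (simp add: indef_def cinner_minus_right)
    then show "indef J y x = 0"
      using indef_commute[of y x] by simp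
  qed
  \<comment> \<open>For \<open>y\<close> J-orthogonal to \<open>L\<close>, the splitting of the test
    vectors shows that \<open>(y, - J y)\<close> lies in the adjoint of \<open>JC\<close>.
    Self-adjointness then puts \<open>y\<close> into the domain of \<open>C\<close>, with image
    \<open>- y\<close>.\<close>
  have M_eq: "J_orthocomplement J L = M"
  proof (intro equalityI subsetI)
    fix y
    assume y: "y \<in> J_orthocomplement J L"
    have "cinner w y = cinner x (- J y)" if "(x, w) \<in> everywhere_op J \<cdot> C" for x w
    proof -
      obtain a b where ab: "a \<in> L" "x = a + b" "J w = a - b"
        using split[of x "J w"] \<open>(x, w) \<in> everywhere_op J \<cdot> C\<close> by (auto simp: J_comp_iff)
      have "indef J a y = 0"
        using y ab(1) indef_commute[of a y] by (simp add: J_orthocomplement_def)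
      then have "indef J (a - b) y = - indef J (a + b) y"
        by (simp add: indef_simps)
      then show ?thesis
        by (simp add: indef_def cinner_J cinner_minus_right flip: ab(2,3))
    qed
    then have "(y, - J y) \<in> adjoint_op (everywhere_op J \<cdot> C)"
      by (auto simp: adjoint_op_def)
    then have "(y, - y) \<in> C"
      using sa by (simp add: selfadjoint_op_def J_comp_iff J_minus)
    then show "y \<in> M"
      by (simp add: M_def)
  qed (auto simp: J_orthocomplement_def orth)
  \<comment> \<open>On vectors fixed by \<open>J\<close> the metric is the squared norm, whereas it
    is negative on \<open>M\<close> off zero.\<close>
  have "z = 0" if "z \<in> J_orthocomplement J L" "J z = z" for z
  proof (rule ccontr)
    assume "z \<noteq> 0"
    then have "Re (indef J z z) < 0"
      using that M_neg by (simp add: M_eq)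
    then show False
      using that(2) by (simp add: indef_def cinner_self flip: of_real_power)
  qed
  then have "maximal_positive J L"
    using positive_subspace_P_plus_image[OF L_pos] by (intro maximal_positiveI[OF L_pos]) blast
  moreover have "decomposes J A L M"
    unfolding decomposes_def J_orthogonal_direct_def
  proof (intro conjI ballI)
    have "0 \<in> L" "0 \<in> M"
      using C_zero by (auto simp: L_def M_def)
    moreover have "x = 0" if "x \<in> L" "x \<in> M" for x
      using orth(1)[OF that] M_neg[OF that(2)] by auto
    ultimately show "L \<inter> M = {0}"
      by blast
    show "indef J x y = 0" if "x \<in> L" "y \<in> M" for x y
      using orth(1)[OF that] .
    have A_add: "x + y \<in> Domain A" if "x \<in> Domain A" "y \<in> Domain A" for x y
      using A that unfolding linear_op_def by blast
    have A_scale: "c *\<^sub>C x \<in> Domain A" if "x \<in> Domain A" for c x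
      using A that unfolding linear_op_def by blast
    have A_diff: "x - y \<in> Domain A" if "x \<in> Domain A" "y \<in> Domain A" for x y
      using A_add[OF that(1) A_scale[OF that(2), of "-1"]] by (simp add: scaleC_one)
    \<comment> \<open>As \<open>C\<close> sends \<open>u\<close> back to \<open>x\<close>, the
      vector \<open>u\<close> lies in the natural domain of \<open>AC\<close>, hence in that of
      \<open>CA\<close>, which is part of the domain of \<open>A\<close>.\<close>
    have C_A: "u \<in> Domain A" if x: "x \<in> Domain A" and "(x, u) \<in> C" for x u
    proof -
      obtain w where "(x, w) \<in> A"
        using x by blast
      then have "(u, w) \<in> A \<cdot> C"
        using C_swap[OF \<open>(x, u) \<in> C\<close>] by blast
      then show ?thesis
        unfolding comm by blast
    qed
    show "Domain A = {x + y |x y. x \<in> Domain A \<inter> L \<and> y \<in> Domain A \<inter> M}" (is "_ = ?S")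
    proof (intro equalityI subsetI)
      fix x
      assume x: "x \<in> Domain A"
      then obtain u where u: "(x, u) \<in> C"
        using dom by blast
      have "u \<in> Domain A"
        using C_A[OF x u] .
      then have "(1/2) *\<^sub>C (x + u) \<in> Domain A" "(1/2) *\<^sub>C (x - u) \<in> Domain A"
        using x by (simp_all add: A_add A_diff A_scale)
      then show "x \<in> ?S"
        using split[OF u] by (smt (verit) IntI mem_Collect_eq)
    qed (use A_add in blast)
    show "op_restrict A L \<subseteq> L \<times> L"
    proof
      fix p
      assume "p \<in> op_restrict A L"
      then obtain x w where p: "p = (x, w)" "(x, w) \<in> A" "(x, x) \<in> C"
        by (auto simp: op_restrict_def L_def)
      \<comment> \<open>Since \<open>C\<close> fixes \<open>x\<close>, \<open>AC\<close> sends
        \<open>x\<close> to \<open>w\<close>. Commutation then says that \<open>C\<close> sends the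
        image of \<open>x\<close> under \<open>A\<close>, again \<open>w\<close>, to
        \<open>w\<close>.\<close>
      then have "(x, w) \<in> C \<cdot> A"
        unfolding comm[symmetric] by blast
      then have "(w, w) \<in> C"
        using A p(2) by (auto simp: linear_op_def single_valued_def)
      then show "p \<in> L \<times> L"
        using p by (simp add: L_def)
    qed
    show "op_restrict A M \<subseteq> M \<times> M"
    proof
      fix p
      assume "p \<in> op_restrict A M"
      then obtain x w where p: "p = (x, w)" "(x, w) \<in> A" "(x, - x) \<in> C"
        by (auto simp: op_restrict_def M_def)
      have "(- 1 *\<^sub>C x, - 1 *\<^sub>C w) \<in> A"
        using A p(2) unfolding linear_op_def by blast
      then have "(- x, - w) \<in> A"
        by (simp add: scaleC_one)
      then have "(x, - w) \<in> C \<cdot> A"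
        unfolding comm[symmetric] using p(3) by blast
      then have "(w, - w) \<in> C"
        using A p(2) by (auto simp: linear_op_def single_valued_def)
      then show "p \<in> M \<times> M"
        using p by (simp add: M_def)
    qed
  qed
  ultimately show ?thesis
    using M_eq by auto
qed

section \<open>From a decomposition to a generalized symmetry\<close>

lemma generalized_C_symmetry_if_decomposes:
  assumes A: "linear_op A" and L: "maximal_positive J L"
    and dec: "decomposes J A L (J_orthocomplement J L)"
  shows "generalized_C_symmetry J A"
proof -
  define M where "M = J_orthocomplement J L"
  define C where "C = {(x + y, x - y) |x y. x \<in> L \<and> y \<in> M}"
  have pos: "positive_subspace J L"
    using L by (simp add: maximal_positive_def)
  then have clL: "closed_csubspace L" and subL: "complex_vector.subspace L"
    by (auto simp: positive_subspace_def closed_csubspace_def)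
  have subM: "complex_vector.subspace M"
    unfolding M_def by (rule csubspace_J_orthocomplement)
  have LM: "L \<inter> M = {0}"
    using dec by (simp add: decomposes_def J_orthogonal_direct_def M_def)
  have MM: "J_orthocomplement J M = L"
    unfolding M_def by (rule J_orthocomplement_twice[OF clL])
  have orth: "indef J x y = 0" "indef J y x = 0" if "x \<in> L" "y \<in> M" for x y
  proof -
    show *: "indef J y x = 0"
      using that by (simp add: M_def J_orthocomplement_def)
    show "indef J x y = 0"
      using * indef_commute[of x y] by simp
  qed
  have uniq: "x = x' \<and> y = y'"
    if "x + y = x' + y'" "x \<in> L" "x' \<in> L" "y \<in> M" "y' \<in> M" for x y x' y'
  proof -
    have "x - x' = y' - y"
      using that(1) by (simp add: algebra_simps)
    then have "x - x' \<in> L \<inter> M"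
      using complex_vector.subspace_diff[OF subL that(2,3)]
        complex_vector.subspace_diff[OF subM that(5,4)] by simp
    then show ?thesis
      using LM that(1) by simp
  qed
  have CI: "(x + y, x - y) \<in> C" if "x \<in> L" "y \<in> M" for x y
    using that by (auto simp: C_def)
  have C_eq: "u = x - y" if xyu: "(x + y, u) \<in> C" and "x \<in> L" "y \<in> M" for x y u
  proof -
    obtain x' y' where "x + y = x' + y'" "u = x' - y'" "x' \<in> L" "y' \<in> M"
      using xyu unfolding C_def by blast
    then show ?thesis
      using uniq that by blast
  qed
  have DomC: "z \<in> Domain C \<longleftrightarrow> (\<exists>x\<in>L. \<exists>y\<in>M. z = x + y)" for z
    by (auto simp: C_def)
  have C_lin: "linear_op C"
    unfolding linear_op_def
  proof (intro conjI allI impI)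
    show "single_valued C"
      unfolding single_valued_def
    proof (intro allI impI)
      fix z u v
      assume zu: "(z, u) \<in> C" and zv: "(z, v) \<in> C"
      obtain x y where "z = x + y" "u = x - y" "x \<in> L" "y \<in> M"
        using zu by (auto simp: C_def)
      then show "u = v"
        using C_eq zv by blast
    qed
    show "(0, 0) \<in> C"
      using CI[of 0 0] complex_vector.subspace_0[OF subL] complex_vector.subspace_0[OF subM] by simp
  next
    fix z u z' u'
    assume "(z, u) \<in> C" "(z', u') \<in> C"
    then obtain x y x' y' where *: "z = x + y" "u = x - y" "x \<in> L" "y \<in> M"
      "z' = x' + y'" "u' = x' - y'" "x' \<in> L" "y' \<in> M"
      by (auto simp: C_def)
    then have "((x + x') + (y + y'), (x + x') - (y + y')) \<in> C"
      by (intro CI complex_vector.subspace_add subL subM)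
    then show "(z + z', u + u') \<in> C"
      by (simp add: * algebra_simps)
  next
    fix c z u
    assume "(z, u) \<in> C"
    then obtain x y where *: "z = x + y" "u = x - y" "x \<in> L" "y \<in> M"
      by (auto simp: C_def)
    then have "(c *\<^sub>C x + c *\<^sub>C y, c *\<^sub>C x - c *\<^sub>C y) \<in> C"
      by (intro CI complex_vector.subspace_scale subL subM)
    then show "(c *\<^sub>C z, c *\<^sub>C u) \<in> C"
      by (simp add: * scaleC_add_right complex_vector.scale_right_diff_distrib)
  qed
  have L_dom: "x \<in> Domain C" if "x \<in> L" for x
    using CI[OF that complex_vector.subspace_0[OF subM]] by auto
  have M_dom: "y \<in> Domain C" if "y \<in> M" for y
    using CI[OF complex_vector.subspace_0[OF subL] that] by auto
  have C_dense: "densely_defined C"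
    unfolding densely_defined_def
  proof (rule csubspace_denseI)
    show "complex_vector.subspace (Domain C)"
      using C_lin unfolding linear_op_def by (intro complex_vector.subspaceI) blast+
    fix y
    assume y: "\<And>x. x \<in> Domain C \<Longrightarrow> cinner y x = 0"
    \<comment> \<open>The two complements are \<open>M\<close> and, by \<open>MM\<close>,
      \<open>L\<close>, which meet only in zero.\<close>
    have "J y \<in> J_orthocomplement J L" "J y \<in> J_orthocomplement J M"
      using y L_dom M_dom by (auto simp: J_orthocomplement_def indef_def)
    then have "J y = 0"
      using LM by (auto simp: MM M_def[symmetric])
    then show "y = 0"
      by (metis J_J J_zero)
  qed
  have C_inv: "C \<cdot> C = Id_on (Domain C)"
  proof -
    have minus_M: "- y \<in> M" if "y \<in> M" for y
      using complex_vector.subspace_neg[OF subM that] .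
    have swap: "(u, z) \<in> C" if zu: "(z, u) \<in> C" for z u
    proof -
      obtain x y where "z = x + y" "u = x - y" "x \<in> L" "y \<in> M"
        using zu by (auto simp: C_def)
      then show ?thesis
        using CI[of x "- y"] minus_M by simp
    qed
    have "z = w" if "(z, u) \<in> C" "(u, w) \<in> C" for z u w
      using C_lin swap[OF that(1)] that(2) unfolding linear_op_def single_valued_def by blast
    then show ?thesis
      using swap by blast
  qed
  have JC_lin: "linear_op (everywhere_op J \<cdot> C)"
    using C_lin unfolding linear_op_def single_valued_def J_comp_iff
    by (simp add: J_add J_scaleC) (metis J_J)
  have JC_dense: "densely_defined (everywhere_op J \<cdot> C)"
  proof -
    have "Domain (everywhere_op J \<cdot> C) = Domain C"
      by (auto simp: everywhere_op_def relcomp_unfold)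
    then show ?thesis
      using C_dense by (simp add: densely_defined_def)
  qed
  have JC_adj: "adjoint_op (everywhere_op J \<cdot> C) = everywhere_op J \<cdot> C"
  proof (intro equalityI subsetI)
    fix p
    assume "p \<in> adjoint_op (everywhere_op J \<cdot> C)"
    moreover obtain y z where p: "p = (y, z)"
      by fastforce
    ultimately have adj: "cinner w y = cinner x z" if "(x, J w) \<in> C" for x w
      using J_comp_iff[of x w C] that by (auto simp: adjoint_op_def)
    have adj': "indef J (a - b) y = indef J (a + b) (J z)" if "a \<in> L" "b \<in> M" for a b
      using adj[of "a + b" "J (a - b)"] CI[OF that] by (simp add: indef_def cinner_J)
    \<comment> \<open>Testing the adjoint relation on \<open>L\<close> and on \<open>M\<close>
      separately places \<open>y - J z\<close> in \<open>M\<close> and \<open>y + J z\<close> in the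
      complement of \<open>M\<close>, which is \<open>L\<close>. Their halves exhibit
      \<open>y\<close> as a vector of the domain that \<open>C\<close> maps to
      \<open>J z\<close>.\<close>
    have 1: "indef J (y - J z) a = 0" if "a \<in> L" for a
      using adj'[OF that complex_vector.subspace_0[OF subM]] indef_commute[of "y - J z" a]
      by (simp add: indef_diff_right)
    have 2: "indef J (y + J z) b = 0" if "b \<in> M" for b
      using adj'[OF complex_vector.subspace_0[OF subL] that] indef_commute[of "y + J z" b]
      by (simp add: indef_def J_minus cinner_minus_left cinner_add_right flip: complex_cnj_add)
        (metis add.right_inverse)
    have "(1/2) *\<^sub>C (y - J z) \<in> M"
      using 1 by (auto simp: M_def J_orthocomplement_def indef_scaleC_left)
    moreover have "(1/2) *\<^sub>C (y + J z) \<in> L"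
      using 2 unfolding MM[symmetric] by (auto simp: J_orthocomplement_def indef_scaleC_left)
    ultimately have "((1/2) *\<^sub>C (y + J z) + (1/2) *\<^sub>C (y - J z),
        (1/2) *\<^sub>C (y + J z) - (1/2) *\<^sub>C (y - J z)) \<in> C"
      by (intro CI)
    moreover have "(1/2) *\<^sub>C (y + J z) + (1/2) *\<^sub>C (y - J z) = y"
      "(1/2) *\<^sub>C (y + J z) - (1/2) *\<^sub>C (y - J z) = J z"
      by (simp_all add: scaleC_add_right complex_vector.scale_right_diff_distrib scaleC_one
          flip: scaleC_add_left)
    ultimately show "p \<in> everywhere_op J \<cdot> C"
      by (simp add: p J_comp_iff)
  next
    fix p
    assume "p \<in> everywhere_op J \<cdot> C"
    then obtain y z where p: "p = (y, z)" "(y, J z) \<in> C"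
      by (cases p) (auto simp: J_comp_iff)
    then obtain a b where ab: "y = a + b" "J z = a - b" "a \<in> L" "b \<in> M"
      by (auto simp: C_def)
    have "cinner w y = cinner x z" if xw: "(x, J w) \<in> C" for x w
    proof -
      obtain c d where cd: "x = c + d" "J w = c - d" "c \<in> L" "d \<in> M"
        using xw by (auto simp: C_def)
      have "cinner w y = indef J (J w) y"
        by (simp add: indef_def)
      also have "\<dots> = indef J x (J z)"
        \<comment> \<open>Both sides reduce to \<open>[c, a] - [d, b]\<close>, the mixed terms being
          zero.\<close>
        by (simp add: ab cd indef_simps orth)
      also have "\<dots> = cinner x z"
        by (simp add: indef_def cinner_J)
      finally show ?thesis .
    qed
    then show "p \<in> adjoint_op (everywhere_op J \<cdot> C)"
      unfolding p(1) adjoint_op_def using J_comp_iff[of _ _ C] by blast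
  qed
  have JC_pos: "positive_op (everywhere_op J \<cdot> C)"
  proof -
    have "0 < cinner w z" if zw: "(z, w) \<in> everywhere_op J \<cdot> C" and nz: "z \<noteq> 0" for z w
    proof -
      obtain a b where ab: "z = a + b" "J w = a - b" "a \<in> L" "b \<in> M"
        using zw by (auto simp: C_def J_comp_iff)
      have "cinner w z = indef J (J w) z"
        by (simp add: indef_def)
      also have "\<dots> = indef J a a - indef J b b"
        by (simp add: ab indef_simps orth)
      finally have eq: "cinner w z = indef J a a - indef J b b" .
      have a: "a \<noteq> 0 \<Longrightarrow> 0 < Re (indef J a a)"
        using pos ab(3) by (auto simp: positive_subspace_def indef_self_pos_iff)
      \<comment> \<open>Here maximality of \<open>L\<close> enters: it makes the complement
        negative, so that both summands of \<open>[a, a] - [b, b]\<close> contribute with the right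
        sign.\<close>
      have b: "b \<noteq> 0 \<Longrightarrow> Re (indef J b b) < 0"
        using maximal_positive_orthocomplement_negative[OF L] ab(4) by (simp add: M_def)
      have "0 < Re (indef J a a) - Re (indef J b b)"
        using a b nz ab(1) by (cases "a = 0"; cases "b = 0") auto
      then show ?thesis
        by (simp add: eq less_complex_def Im_indef_self)
    qed
    then show ?thesis
      unfolding positive_op_def by blast
  qed
  have DomA: "Domain A = {x + y |x y. x \<in> Domain A \<inter> L \<and> y \<in> Domain A \<inter> M}"
    using dec by (simp add: decomposes_def M_def)
  have A_L: "w \<in> L" if "(x, w) \<in> A" "x \<in> L" for x w
    using dec that by (auto simp: decomposes_def op_restrict_def)
  have A_M: "w \<in> M" if "(x, w) \<in> A" "x \<in> M" for x w
    using dec that by (auto simp: decomposes_def op_restrict_def M_def)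
  have A_add: "(x + y, u + v) \<in> A" if "(x, u) \<in> A" "(y, v) \<in> A" for x y u v
    using A that by (auto simp: linear_op_def)
  have A_diff: "(x - y, u - v) \<in> A" if "(x, u) \<in> A" "(y, v) \<in> A" for x y u v
  proof -
    have "(- 1 *\<^sub>C y, - 1 *\<^sub>C v) \<in> A"
      using A that unfolding linear_op_def by blast
    then have "(- y, - v) \<in> A"
      by (simp add: scaleC_one)
    then show ?thesis
      using A_add[OF that(1), of "- y" "- v"] by simp
  qed
  have A_fun: "u = v" if "(x, u) \<in> A" "(x, v) \<in> A" for x u v
    using A that by (auto simp: linear_op_def single_valued_def)
  have A_dom: "\<exists>a b u v. z = a + b \<and> a \<in> L \<and> b \<in> M \<and> (a, u) \<in> A \<and> (b, v) \<in> A"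
    if "z \<in> Domain A" for z
    \<comment> \<open>\<open>Domain A\<close> occurs on both sides of \<open>DomA\<close>, so it is
      rewritten only once.\<close>
    using that by (subst (asm) DomA) blast
  have sub: "Domain A \<subseteq> Domain C"
    using A_dom DomC by blast
  have comm: "A \<cdot> C = C \<cdot> A"
  proof (intro equalityI subsetI)
    fix p
    assume "p \<in> A \<cdot> C"
    then obtain z u w where p: "p = (z, w)" "(z, u) \<in> C" "(u, w) \<in> A"
      by auto
    obtain x y where xy: "z = x + y" "u = x - y" "x \<in> L" "y \<in> M"
      using p(2) by (auto simp: C_def)
    obtain a b s t where ab: "u = a + b" "a \<in> L" "b \<in> M" "(a, s) \<in> A" "(b, t) \<in> A"
      using A_dom[of u] p(3) by blast
    \<comment> \<open>The decomposition splits \<open>u\<close> inside the domain of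
      \<open>A\<close>, and uniqueness matches this splitting with \<open>x - y\<close>. So
      \<open>z\<close> is a difference of two vectors of that domain and lies in it too.\<close>
    have "x = a \<and> - y = b"
      by (rule uniq) (use xy ab complex_vector.subspace_neg[OF subM] in auto)
    then have z: "z = a - b"
      using xy(1) by auto
    have w: "w = s + t"
      using A_fun[OF p(3)] A_add[OF ab(4,5)] ab(1) by simp
    have "(z, s - t) \<in> A"
      unfolding z by (rule A_diff[OF ab(4,5)])
    moreover have "(s - t, w) \<in> C"
      using CI[OF A_L[OF ab(4,2)] complex_vector.subspace_neg[OF subM A_M[OF ab(5,3)]]] w by simp
    ultimately show "p \<in> C \<cdot> A"
      unfolding p(1) by blast
  next
    fix p
    assume "p \<in> C \<cdot> A"
    then obtain z u w where p: "p = (z, w)" "(z, u) \<in> A" "(u, w) \<in> C"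
      by auto
    obtain a b s t where ab: "z = a + b" "a \<in> L" "b \<in> M" "(a, s) \<in> A" "(b, t) \<in> A"
      using A_dom[of z] p(2) by blast
    have "u = s + t"
      using A_fun[OF p(2)] A_add[OF ab(4,5)] ab(1) by simp
    then have "w = s - t"
      using p(3) C_eq A_L[OF ab(4,2)] A_M[OF ab(5,3)] by blast
    \<comment> \<open>Conversely the components of \<open>z\<close> lie in the domain of
      \<open>A\<close>, hence so does \<open>a - b\<close>, the image of \<open>z\<close> under
      \<open>C\<close>.\<close>
    then have "(a - b, w) \<in> A"
      using A_diff[OF ab(4,5)] by simp
    then show "p \<in> A \<cdot> C"
      using CI[OF ab(2,3)] unfolding p(1) ab(1) by blast
  qed
  show ?thesis
    unfolding generalized_C_symmetry_def selfadjoint_op_def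
    using C_lin C_dense C_inv JC_lin JC_dense JC_adj JC_pos sub comm by blast
qed

end

theorem proposition4p2:
  fixes J :: "'a::complex_hilbert \<Rightarrow> 'a" and A :: "'a op"
  assumes "fundamental_symmetry J"
    and "infinite_dimensional (range (P_plus J))"
    and "infinite_dimensional (range (P_minus J))"
    and "J_selfadjoint J A"
  shows "generalized_C_symmetry J A \<longleftrightarrow>
    (\<exists>L. maximal_positive J L \<and> decomposes J A L (J_orthocomplement J L))"
proof -
  interpret krein_space J
    by unfold_locales (fact assms(1))
  have "linear_op A"
    using assms(4) by (simp add: J_selfadjoint_def)
  then show ?thesis
    using decomposes_if_generalized_C_symmetry generalized_C_symmetry_if_decomposes by blast
qed

end
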